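(* Let $(X,\tau)$ be a locally solid Riesz space, $F$ a Riesz algebra, and $T:X\to F$ an order bounded disjointness preserving $\mathbb{mo}$-$KB$-operator. If $S:X\to F$ is an operator (possessing a modulus $|S|$) with $|S|\le|T|$, then $S$ is an $\mathbb{mo}$-$KB$-operator. The same holds with "$\mathbb{mo}$-$KB$" replaced throughout by "$\mathbb{m}_l\mathbb{o}$-$KB$", and with "$\mathbb{mo}$-$KB$" replaced throughout by "$\mathbb{m}_r\mathbb{o}$-$KB$".
   Context: All vector spaces are real and all operators are linear. A Riesz algebra is a Riesz space $F$ that is an associative algebra with $x\cdot y\in F_+$ whenever $x,y\in F_+$. Order convergence: a net $x_\alpha\xrightarrow{\mathbb{o}}x$ in a Riesz space if there is a net $y_\beta\downarrow 0$ such that for every $\beta$ there is $\alpha_\beta$ with $|x_\alpha-x|\le y_\beta$ for all $\alpha\ge\alpha_\beta$. In a Riesz algebra $F$: $x_\alpha\xrightarrow{\mathbb{m}_l\mathbb{o}}x$ means $u\cdot|x_\alpha-x|\xrightarrow{\mathbb{o}}0$ for all $u\in F_+$; $x_\alpha\xrightarrow{\mathbb{m}_r\mathbb{o}}x$ means $|x_\alpha-x|\cdot u\xrightarrow{\mathbb{o}}0$ for all $u\in F_+$; $x_\alpha\xrightarrow{\mathbb{m}\mathbb{o}}x$ means both hold. An operator $T:X\to F$ is an $\mathbb{mo}$-$KB$-operator (respectively $\mathbb{m}_l\mathbb{o}$-$KB$-, $\mathbb{m}_r\mathbb{o}$-$KB$-operator) if for every $\tau$-bounded increasing net $x_\alpha$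 in $X_+$ there is $x\in X$ with $Tx_\alpha\xrightarrow{\mathbb{mo}}Tx$ (respectively $Tx_\alpha\xrightarrow{\mathbb{m}_l\mathbb{o}}Tx$, $Tx_\alpha\xrightarrow{\mathbb{m}_r\mathbb{o}}Tx$). $T$ is order bounded if it maps order bounded sets to order bounded sets, and disjointness preserving if $|x|\wedge|y|=0$ implies $|Tx|\wedge|Ty|=0$. The modulus $|S|$ of an operator $S$ is the supremum of $S$ and $-S$ in the ordered space of operators from $X$ to $F$ (when it exists); $R\le Q$ means $Q-R$ is positive. The paper's standing convention on an order bounded disjointness preserving operator $T$ is that its modulus $|T|$ exists and satisfies $|T||x|=|T(|x|)|=|Tx|$ for all $x\in X$. *)

theory Defs
  imports "HOL-Analysis.Analysis" "HOL-Library.Lattice_Algebras"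
begin

class riesz_space = ordered_real_vector + lattice_ab_group_add_abs

text \<open>Monotonicity of multiplication by positive elements, as in \<^class>\<open>ordered_ring\<close>, says
  that products of positive elements are positive. There is no unit and no commutativity.\<close>

class riesz_algebra = riesz_space + real_algebra + lattice_ring

definition solid :: "'a::riesz_space set \<Rightarrow> bool" where
  "solid V \<longleftrightarrow> (\<forall>x\<in>V. \<forall>y. \<bar>y\<bar> \<le> \<bar>x\<bar> \<longrightarrow> y \<in> V)"

definition zero_nbhd :: "'a::zero topology \<Rightarrow> 'a set \<Rightarrow> bool" where
  "zero_nbhd \<tau> V \<longleftrightarrow> (\<exists>W. openin \<tau> W \<and> 0 \<in> W \<and> W \<subseteq> V)"

definition linear_topology :: "'a::real_vector topology \<Rightarrow> bool" where
  "linear_topology \<tau> \<longleftrightarrow>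
     topspace \<tau> = UNIV \<and>
     continuous_map (prod_topology \<tau> \<tau>) \<tau> (\<lambda>(x, y). x + y) \<and>
     continuous_map (prod_topology euclideanreal \<tau>) \<tau> (\<lambda>(c, x). c *\<^sub>R x)"

text \<open>No Hausdorff separation is required.\<close>

definition locally_solid :: "'a::riesz_space topology \<Rightarrow> bool" where
  "locally_solid \<tau> \<longleftrightarrow>
     linear_topology \<tau> \<and>
     (\<forall>U. zero_nbhd \<tau> U \<longrightarrow> (\<exists>V. zero_nbhd \<tau> V \<and> solid V \<and> V \<subseteq> U))"

definition topologically_bounded :: "'a::real_vector topology \<Rightarrow> 'a set \<Rightarrow> bool" where
  "topologically_bounded \<tau> B \<longleftrightarrow>
     (\<forall>U. zero_nbhd \<tau> U \<longrightarrow> (\<exists>c>0. (\<lambda>x. c *\<^sub>R x) ` B \<subseteq> U))"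

text \<open>A net is a triple \<open>A\<close>, \<open>le\<close>, \<open>x\<close>: a nonempty index set, a directed preorder on it,
  and a function of which only the values on \<open>A\<close> matter.\<close>

definition directed :: "'i set \<Rightarrow> ('i \<Rightarrow> 'i \<Rightarrow> bool) \<Rightarrow> bool" where
  "directed A le \<longleftrightarrow>
     A \<noteq> {} \<and>
     (\<forall>a\<in>A. le a a) \<and>
     (\<forall>a\<in>A. \<forall>b\<in>A. \<forall>c\<in>A. le a b \<longrightarrow> le b c \<longrightarrow> le a c) \<and>
     (\<forall>a\<in>A. \<forall>b\<in>A. \<exists>c\<in>A. le a c \<and> le b c)"

lemma directed_nonempty: "directed A le \<Longrightarrow> A \<noteq> {}"
  unfolding directed_def by (rule conjunct1)

lemma directed_upper_bound:
  "directed A le \<Longrightarrow> a \<in> A \<Longrightarrow> b \<in> A \<Longrightarrow> \<exists>c\<in>A. le a c \<and> le b c"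
  unfolding directed_def by (drule conjunct2, drule conjunct2, drule conjunct2) (drule (1) bspec, erule (1) bspec)

definition increasing_net :: "'i set \<Rightarrow> ('i \<Rightarrow> 'i \<Rightarrow> bool) \<Rightarrow> ('i \<Rightarrow> 'a::order) \<Rightarrow> bool" where
  "increasing_net A le x \<longleftrightarrow> directed A le \<and> (\<forall>a\<in>A. \<forall>b\<in>A. le a b \<longrightarrow> x a \<le> x b)"

definition decreases_to_zero ::
    "'i set \<Rightarrow> ('i \<Rightarrow> 'i \<Rightarrow> bool) \<Rightarrow> ('i \<Rightarrow> 'a::riesz_space) \<Rightarrow> bool" where
  "decreases_to_zero B le y \<longleftrightarrow>
     directed B le \<and>
     (\<forall>a\<in>B. \<forall>b\<in>B. le a b \<longrightarrow> y b \<le> y a) \<and>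
     (\<forall>b\<in>B. 0 \<le> y b) \<and> (\<forall>z. (\<forall>b\<in>B. z \<le> y b) \<longrightarrow> z \<le> 0)"

text \<open>HOL cannot quantify over the type of the indices of the dominating net, so these are
  drawn from the space itself. Nothing is lost, since a decreasing net can be reindexed by its
  range: see \<open>o_convI\<close> below.\<close>

definition o_conv ::
    "'i set \<Rightarrow> ('i \<Rightarrow> 'i \<Rightarrow> bool) \<Rightarrow> ('i \<Rightarrow> 'a::riesz_space) \<Rightarrow> 'a \<Rightarrow> bool" where
  "o_conv A le x l \<longleftrightarrow>
     (\<exists>(B :: 'a set) le' y. decreases_to_zero B le' y \<and>
        (\<forall>b\<in>B. \<exists>a\<in>A. \<forall>a'\<in>A. le a a' \<longrightarrow> \<bar>x a' - l\<bar> \<le> y b))"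

lemma o_convI:
  fixes B :: "'j set" and x :: "'i \<Rightarrow> 'a::riesz_space"
  assumes y: "decreases_to_zero B le' y"
    and dom: "\<forall>b\<in>B. \<exists>a\<in>A. \<forall>a'\<in>A. le a a' \<longrightarrow> \<bar>x a' - l\<bar> \<le> y b"
  shows "o_conv A le x l"
  unfolding o_conv_def
proof (intro exI conjI)
  have B: "directed B le'" and dec: "\<forall>a\<in>B. \<forall>b\<in>B. le' a b \<longrightarrow> y b \<le> y a"
    and inf: "\<forall>b\<in>B. 0 \<le> y b" "\<forall>z. (\<forall>b\<in>B. z \<le> y b) \<longrightarrow> z \<le> 0"
    using y unfolding decreases_to_zero_def by blast+
  have "\<exists>c\<in>B. y c \<le> y a \<and> y c \<le> y b" if "a \<in> B" "b \<in> B" for a b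
    using directed_upper_bound[OF B that] dec that by blast
  then have up: "\<forall>p\<in>y ` B. \<forall>q\<in>y ` B. \<exists>r\<in>y ` B. r \<le> p \<and> r \<le> q"
    by simp
  have "directed (y ` B) (\<lambda>p q. q \<le> p)"
    unfolding directed_def by (intro conjI up) (use directed_nonempty[OF B] in auto)
  then show "decreases_to_zero (y ` B) (\<lambda>p q. q \<le> p) (\<lambda>p. p)"
    using inf unfolding decreases_to_zero_def by simp
  show "\<forall>b\<in>y ` B. \<exists>a\<in>A. \<forall>a'\<in>A. le a a' \<longrightarrow> \<bar>x a' - l\<bar> \<le> b"
    using dom by blast
qed

definition mlo_conv ::
    "'i set \<Rightarrow> ('i \<Rightarrow> 'i \<Rightarrow> bool) \<Rightarrow> ('i \<Rightarrow> 'a::riesz_algebra) \<Rightarrow> 'a \<Rightarrow> bool" where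
  "mlo_conv A le x l \<longleftrightarrow> (\<forall>u\<ge>0. o_conv A le (\<lambda>a. u * \<bar>x a - l\<bar>) 0)"

definition mro_conv ::
    "'i set \<Rightarrow> ('i \<Rightarrow> 'i \<Rightarrow> bool) \<Rightarrow> ('i \<Rightarrow> 'a::riesz_algebra) \<Rightarrow> 'a \<Rightarrow> bool" where
  "mro_conv A le x l \<longleftrightarrow> (\<forall>u\<ge>0. o_conv A le (\<lambda>a. \<bar>x a - l\<bar> * u) 0)"

definition mo_conv ::
    "'i set \<Rightarrow> ('i \<Rightarrow> 'i \<Rightarrow> bool) \<Rightarrow> ('i \<Rightarrow> 'a::riesz_algebra) \<Rightarrow> 'a \<Rightarrow> bool" where
  "mo_conv A le x l \<longleftrightarrow> mlo_conv A le x l \<and> mro_conv A le x l"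

definition bounded_increasing_positive_net ::
    "'a::riesz_space topology \<Rightarrow> 'i set \<Rightarrow> ('i \<Rightarrow> 'i \<Rightarrow> bool) \<Rightarrow> ('i \<Rightarrow> 'a) \<Rightarrow> bool" where
  "bounded_increasing_positive_net \<tau> A le x \<longleftrightarrow>
     increasing_net A le x \<and> (\<forall>a\<in>A. 0 \<le> x a) \<and> topologically_bounded \<tau> (x ` A)"

text \<open>For the same reason the nets below have their indices in the domain of the operator. By
  the lemmas \<open>mlo_KB_net\<close>, \<open>mro_KB_net\<close> and \<open>mo_KB_net\<close> the defining property then holds for
  nets indexed by any type. The predicates are meant for linear \<open>T\<close>.\<close>

definition mlo_KB ::
    "'x::riesz_space topology \<Rightarrow> ('x \<Rightarrow> 'f::riesz_algebra) \<Rightarrow> bool" where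
  "mlo_KB \<tau> T \<longleftrightarrow>
     (\<forall>(A :: 'x set) le x. bounded_increasing_positive_net \<tau> A le x \<longrightarrow>
        (\<exists>l. mlo_conv A le (\<lambda>a. T (x a)) (T l)))"

definition mro_KB ::
    "'x::riesz_space topology \<Rightarrow> ('x \<Rightarrow> 'f::riesz_algebra) \<Rightarrow> bool" where
  "mro_KB \<tau> T \<longleftrightarrow>
     (\<forall>(A :: 'x set) le x. bounded_increasing_positive_net \<tau> A le x \<longrightarrow>
        (\<exists>l. mro_conv A le (\<lambda>a. T (x a)) (T l)))"

definition mo_KB ::
    "'x::riesz_space topology \<Rightarrow> ('x \<Rightarrow> 'f::riesz_algebra) \<Rightarrow> bool" where
  "mo_KB \<tau> T \<longleftrightarrow>
     (\<forall>(A :: 'x set) le x. bounded_increasing_positive_net \<tau> A le x \<longrightarrow>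
        (\<exists>l. mo_conv A le (\<lambda>a. T (x a)) (T l)))"

lemma bounded_increasing_positive_net_range:
  assumes "bounded_increasing_positive_net \<tau> A le x"
  shows "bounded_increasing_positive_net \<tau> (x ` A) (\<le>) (\<lambda>p. p)"
proof -
  have A: "directed A le" and inc: "\<forall>a\<in>A. \<forall>b\<in>A. le a b \<longrightarrow> x a \<le> x b"
    using assms unfolding bounded_increasing_positive_net_def increasing_net_def by blast+
  have "\<exists>c\<in>A. x a \<le> x c \<and> x b \<le> x c" if "a \<in> A" "b \<in> A" for a b
    using directed_upper_bound[OF A that] inc that by blast
  then have up: "\<forall>p\<in>x ` A. \<forall>q\<in>x ` A. \<exists>r\<in>x ` A. p \<le> r \<and> q \<le> r"
    by simp
  have "directed (x ` A) (\<le>)"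
    unfolding directed_def by (intro conjI up) (use directed_nonempty[OF A] in auto)
  then show ?thesis
    using assms unfolding bounded_increasing_positive_net_def increasing_net_def by simp
qed

lemma o_conv_reindex:
  fixes x :: "'i \<Rightarrow> 'p::order" and f :: "'p \<Rightarrow> 'a::riesz_space"
  assumes "increasing_net A le x" and "o_conv (x ` A) (\<le>) f l"
  shows "o_conv A le (\<lambda>a. f (x a)) l"
proof -
  obtain B :: "'a set" and le' y where y: "decreases_to_zero B le' y"
    and dom: "\<forall>b\<in>B. \<exists>p\<in>x ` A. \<forall>q\<in>x ` A. p \<le> q \<longrightarrow> \<bar>f q - l\<bar> \<le> y b"
    using assms(2) unfolding o_conv_def by auto
  have "\<forall>b\<in>B. \<exists>a\<in>A. \<forall>a'\<in>A. le a a' \<longrightarrow> \<bar>f (x a') - l\<bar> \<le> y b"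
    using dom assms(1) unfolding increasing_net_def by blast
  with y show ?thesis by (rule o_convI)
qed

lemma mlo_KB_net:
  fixes A :: "'i set"
  assumes "mlo_KB \<tau> T" and x: "bounded_increasing_positive_net \<tau> A le x"
  shows "\<exists>l. mlo_conv A le (\<lambda>a. T (x a)) (T l)"
proof -
  obtain l where "mlo_conv (x ` A) (\<le>) (\<lambda>p. T p) (T l)"
    using assms(1) bounded_increasing_positive_net_range[OF x] unfolding mlo_KB_def by blast
  moreover have "increasing_net A le x"
    using x unfolding bounded_increasing_positive_net_def by blast
  ultimately have "mlo_conv A le (\<lambda>a. T (x a)) (T l)"
    unfolding mlo_conv_def by (auto intro: o_conv_reindex)
  then show ?thesis ..
qed

lemma mro_KB_net:
  fixes A :: "'i set"
  assumes "mro_KB \<tau> T" and x: "bounded_increasing_positive_net \<tau> A le x"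
  shows "\<exists>l. mro_conv A le (\<lambda>a. T (x a)) (T l)"
proof -
  obtain l where "mro_conv (x ` A) (\<le>) (\<lambda>p. T p) (T l)"
    using assms(1) bounded_increasing_positive_net_range[OF x] unfolding mro_KB_def by blast
  moreover have "increasing_net A le x"
    using x unfolding bounded_increasing_positive_net_def by blast
  ultimately have "mro_conv A le (\<lambda>a. T (x a)) (T l)"
    unfolding mro_conv_def by (auto intro: o_conv_reindex)
  then show ?thesis ..
qed

lemma mo_KB_net:
  fixes A :: "'i set"
  assumes "mo_KB \<tau> T" and x: "bounded_increasing_positive_net \<tau> A le x"
  shows "\<exists>l. mo_conv A le (\<lambda>a. T (x a)) (T l)"
proof -
  obtain l where "mo_conv (x ` A) (\<le>) (\<lambda>p. T p) (T l)"
    using assms(1) bounded_increasing_positive_net_range[OF x] unfolding mo_KB_def by blast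
  moreover have "increasing_net A le x"
    using x unfolding bounded_increasing_positive_net_def by blast
  ultimately have "mo_conv A le (\<lambda>a. T (x a)) (T l)"
    unfolding mo_conv_def mlo_conv_def mro_conv_def by (auto intro: o_conv_reindex)
  then show ?thesis ..
qed

definition order_bounded_set :: "'a::order set \<Rightarrow> bool" where
  "order_bounded_set B \<longleftrightarrow> (\<exists>a b. B \<subseteq> {a..b})"

definition order_bounded :: "('x::order \<Rightarrow> 'f::order) \<Rightarrow> bool" where
  "order_bounded T \<longleftrightarrow> (\<forall>B. order_bounded_set B \<longrightarrow> order_bounded_set (T ` B))"

definition disjointness_preserving :: "('x::riesz_space \<Rightarrow> 'f::riesz_space) \<Rightarrow> bool" where
  "disjointness_preserving T \<longleftrightarrow>
     (\<forall>x y. inf (\<bar>x\<bar>) (\<bar>y\<bar>) = 0 \<longrightarrow> inf (\<bar>T x\<bar>) (\<bar>T y\<bar>) = 0)"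

definition op_le :: "('x::riesz_space \<Rightarrow> 'f::riesz_space) \<Rightarrow> ('x \<Rightarrow> 'f) \<Rightarrow> bool" where
  "op_le R Q \<longleftrightarrow> (\<forall>x\<ge>0. 0 \<le> Q x - R x)"

text \<open>\<open>is_modulus S R\<close>: the operator \<open>R\<close> is the supremum of \<open>S\<close> and \<open>-S\<close> among all linear
  operators. It is unique, because the positive elements span the domain.\<close>

definition is_modulus :: "('x::riesz_space \<Rightarrow> 'f::riesz_space) \<Rightarrow> ('x \<Rightarrow> 'f) \<Rightarrow> bool" where
  "is_modulus S R \<longleftrightarrow>
     linear R \<and> op_le S R \<and> op_le (\<lambda>x. - S x) R \<and>
     (\<forall>Q. linear Q \<longrightarrow> op_le S Q \<longrightarrow> op_le (\<lambda>x. - S x) Q \<longrightarrow> op_le R Q)"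

end

theory Submission
  imports Defs
begin

text \<open>The convention \<open>|T||x| = |T x|\<close> turns \<open>|S| \<le> |T|\<close> into the pointwise estimate
  \<open>|S x| \<le> |S||x| \<le> |T||x| = |T x|\<close>, valid for every \<open>x\<close> and not just for positive ones
  (lemma \<open>modulus_dominated_abs_le\<close>). Applied to \<open>x\<^sub>\<alpha> - x\<close>, it gives
  \<open>|S x\<^sub>\<alpha> - S x| \<le> |T x\<^sub>\<alpha> - T x|\<close> by linearity. So the same \<open>x\<close> that serves
  \<open>T\<close> for a bounded increasing net serves \<open>S\<close>: multiplication by a positive \<open>u\<close> is
  monotone, and order convergence to zero passes to dominated nets.\<close>

text \<open>Splitting \<open>x\<close> into its positive and negative parts reduces the estimate to the positive
  cone, where \<open>R\<close> is known to dominate both \<open>S\<close> and \<open>- S\<close>.\<close>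

lemma abs_le_of_op_le:
  fixes S R :: "'x::riesz_space \<Rightarrow> 'f::riesz_space"
  assumes "linear S" and "linear R" and "op_le S R" and "op_le (\<lambda>x. - S x) R"
  shows "\<bar>S x\<bar> \<le> R \<bar>x\<bar>"
proof -
  have le: "S y \<le> R y" "- S y \<le> R y" if "0 \<le> y" for y
    using assms(3,4) that unfolding op_le_def by (metis diff_ge_0_iff_ge)+
  have pos: "0 \<le> pprt x" and neg: "0 \<le> - nprt x"
    by simp_all
  have "S x = S (pprt x) - S (- nprt x)"
    using linear_diff[OF assms(1), of "pprt x" "- nprt x"] prts[of x] by simp
  moreover have "R \<bar>x\<bar> = R (pprt x) + R (- nprt x)"
    using linear_add[OF assms(2), of "pprt x" "- nprt x"] abs_prts[of x] by simp
  moreover have "S (pprt x) + - S (- nprt x) \<le> R (pprt x) + R (- nprt x)"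
    by (intro add_mono le pos neg)
  moreover have "- S (pprt x) + S (- nprt x) \<le> R (pprt x) + R (- nprt x)"
    by (intro add_mono le pos neg)
  ultimately show ?thesis
    by (intro abs_leI) simp_all
qed

lemma modulus_dominated_abs_le:
  fixes S :: "'x::riesz_space \<Rightarrow> 'f::riesz_space"
  assumes "linear S" and "is_modulus S absS" and "op_le absS absT"
    and "\<And>x. absT \<bar>x\<bar> = \<bar>T x\<bar>"
  shows "\<bar>S x\<bar> \<le> \<bar>T x\<bar>"
proof -
  have "\<bar>S x\<bar> \<le> absS \<bar>x\<bar>"
    using assms(1,2) unfolding is_modulus_def by (blast intro: abs_le_of_op_le)
  also have "absS \<bar>x\<bar> \<le> absT \<bar>x\<bar>"
    using assms(3) unfolding op_le_def by (metis abs_ge_zero diff_ge_0_iff_ge)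
  finally show ?thesis
    using assms(4) by simp
qed

lemma o_conv_zero_dominated:
  assumes "o_conv A le g 0" and "\<And>a. \<bar>f a\<bar> \<le> \<bar>g a\<bar>"
  shows "o_conv A le f 0"
  using assms unfolding o_conv_def by (auto; meson order_trans)

lemma mlo_conv_dominated:
  assumes "mlo_conv A le g l" and "\<And>a. \<bar>f a - k\<bar> \<le> \<bar>g a - l\<bar>"
  shows "mlo_conv A le f k"
  unfolding mlo_conv_def
proof (intro allI impI)
  fix u :: 'b
  assume u: "0 \<le> u"
  have "\<bar>u * \<bar>f a - k\<bar>\<bar> \<le> \<bar>u * \<bar>g a - l\<bar>\<bar>" for a
    using mult_left_mono[OF assms(2) u] u by (simp add: mult_nonneg_nonneg)
  then show "o_conv A le (\<lambda>a. u * \<bar>f a - k\<bar>) 0"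
    using assms(1) u unfolding mlo_conv_def by (blast intro: o_conv_zero_dominated)
qed

lemma mro_conv_dominated:
  assumes "mro_conv A le g l" and "\<And>a. \<bar>f a - k\<bar> \<le> \<bar>g a - l\<bar>"
  shows "mro_conv A le f k"
  unfolding mro_conv_def
proof (intro allI impI)
  fix u :: 'b
  assume u: "0 \<le> u"
  have "\<bar>\<bar>f a - k\<bar> * u\<bar> \<le> \<bar>\<bar>g a - l\<bar> * u\<bar>" for a
    using mult_right_mono[OF assms(2) u] u by (simp add: mult_nonneg_nonneg)
  then show "o_conv A le (\<lambda>a. \<bar>f a - k\<bar> * u) 0"
    using assms(1) u unfolding mro_conv_def by (blast intro: o_conv_zero_dominated)
qed

theorem theorem3p3:
  fixes \<tau> :: "'x::riesz_space topology"
    and T S absT absS :: "'x \<Rightarrow> 'f::riesz_algebra"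
  assumes "locally_solid \<tau>"
    and "linear T" and "order_bounded T" and "disjointness_preserving T"
    and "is_modulus T absT"
    and "\<forall>x. absT \<bar>x\<bar> = \<bar>T \<bar>x\<bar>\<bar> \<and> \<bar>T \<bar>x\<bar>\<bar> = \<bar>T x\<bar>"
    and "linear S" and "is_modulus S absS"
    and "op_le absS absT"
  shows "(mo_KB \<tau> T \<longrightarrow> mo_KB \<tau> S) \<and>
         (mlo_KB \<tau> T \<longrightarrow> mlo_KB \<tau> S) \<and>
         (mro_KB \<tau> T \<longrightarrow> mro_KB \<tau> S)"
proof -
  have absT: "absT \<bar>x\<bar> = \<bar>T x\<bar>" for x
    using assms(6) by metis
  have "\<bar>S (y - l)\<bar> \<le> \<bar>T (y - l)\<bar>" for y l
    using assms(7-9) absT by (rule modulus_dominated_abs_le)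
  then have dom: "\<bar>S y - S l\<bar> \<le> \<bar>T y - T l\<bar>" for y l
    by (simp add: linear_diff[OF assms(2)] linear_diff[OF assms(7)])
  have left: "mlo_conv A le (\<lambda>a. S (x a)) (S l)"
    if "mlo_conv A le (\<lambda>a. T (x a)) (T l)" for A :: "'x set" and le x l
    using that dom by (rule mlo_conv_dominated)
  have right: "mro_conv A le (\<lambda>a. S (x a)) (S l)"
    if "mro_conv A le (\<lambda>a. T (x a)) (T l)" for A :: "'x set" and le x l
    using that dom by (rule mro_conv_dominated)
  show ?thesis
    unfolding mo_KB_def mlo_KB_def mro_KB_def mo_conv_def using left right by meson
qed

end
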